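(* Let $G$ be a $2$-edge-connected non-bipartite graph. Then there exists an optimal ear decomposition of $G$ starting with an odd cycle. As a consequence, $\varphi_{\rm odd}(G)=\varphi(G)$.
   Context: Graphs are finite and simple. $2$-edge-connected means connected and bridgeless. Given a graph $H'$, adding an ear to $H'$ means taking two vertices $a,b$ of $H'$ and adding a path from $a$ to $b$ all of whose vertices other than $a,b$ are new; $a=b$ is allowed (closed ear, i.e. a cycle through $a$). An ear is odd (even) if it has an odd (even) number of edges. An ear decomposition of a $2$-edge-connected graph $G$ is a sequence $F_0,F_1,\dots,F_s$ with union $G$, where $F_0$ is a cycle (itself counted as an odd or even ear according to its length) and, for $i\ge1$, $F_i$ is an ear added to $F_0\cup\dots\cup F_{i-1}$. $\varphi(G)$ is the minimum number of even ears over all ear decompositions of $G$, and an ear decomposition with exactly $\varphi(G)$ even ears is called optimal. $\varphi_{\rm odd}(G)$ is the minimum number of even ears over those ear decompositions whose first ear $F_0$ is an odd cycle. *)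

theory Defs
  imports Main
begin

section \<open>Simple graphs\<close>

text \<open>A graph is given by its vertex set \<open>V\<close> and its edge set \<open>E\<close>, an edge being the
  two-element set of its endpoints.\<close>

definition simple_graph :: "'a set \<Rightarrow> 'a set set \<Rightarrow> bool" where
  "simple_graph V E \<longleftrightarrow> finite V \<and> (\<forall>e\<in>E. e \<subseteq> V \<and> card e = 2)"

definition joined :: "'a set set \<Rightarrow> 'a \<Rightarrow> 'a \<Rightarrow> bool" where
  "joined E u v \<longleftrightarrow> (u, v) \<in> {(x, y). {x, y} \<in> E}\<^sup>*"

definition graph_connected :: "'a set \<Rightarrow> 'a set set \<Rightarrow> bool" where
  "graph_connected V E \<longleftrightarrow> V \<noteq> {} \<and> (\<forall>u\<in>V. \<forall>v\<in>V. joined E u v)"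

definition bridge :: "'a set \<Rightarrow> 'a set set \<Rightarrow> 'a set \<Rightarrow> bool" where
  "bridge V E e \<longleftrightarrow> e \<in> E \<and> (\<exists>u\<in>V. \<exists>v\<in>V. joined E u v \<and> \<not> joined (E - {e}) u v)"

definition two_edge_connected :: "'a set \<Rightarrow> 'a set set \<Rightarrow> bool" where
  "two_edge_connected V E \<longleftrightarrow> graph_connected V E \<and> (\<nexists>e. bridge V E e)"

definition bipartite :: "'a set \<Rightarrow> 'a set set \<Rightarrow> bool" where
  "bipartite V E \<longleftrightarrow>
     (\<exists>A B. A \<union> B = V \<and> A \<inter> B = {} \<and> (\<forall>e\<in>E. \<exists>a\<in>A. \<exists>b\<in>B. e = {a, b}))"


section \<open>Paths, cycles and ears\<close>

text \<open>Paths and cycles are represented by the list of vertices met when traversing them; for a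
  cycle the starting vertex is repeated at the end. A list with \<open>n + 1\<close> entries thus has \<open>n\<close>
  edges, in both cases.\<close>

definition trail_edges :: "'a list \<Rightarrow> 'a set set" where
  "trail_edges p = {{p ! i, p ! Suc i} | i. Suc i < length p}"

definition num_edges :: "'a list \<Rightarrow> nat" where
  "num_edges p = length p - 1"

definition is_path :: "'a list \<Rightarrow> bool" where
  "is_path p \<longleftrightarrow> num_edges p \<ge> 1 \<and> distinct p"

text \<open>Graphs are simple, so a cycle has at least three edges.\<close>

definition is_cycle :: "'a list \<Rightarrow> bool" where
  "is_cycle p \<longleftrightarrow> num_edges p \<ge> 3 \<and> hd p = last p \<and> distinct (tl p)"

text \<open>\<open>p\<close> is an ear that can be added to the graph \<open>(V, E)\<close>. The set \<open>set (butlast (tl p))\<close>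
  consists of the vertices other than the two ends. The last conjunct only matters for an ear
  with a single edge: that edge has to be new.\<close>

definition is_ear :: "'a set \<Rightarrow> 'a set set \<Rightarrow> 'a list \<Rightarrow> bool" where
  "is_ear V E p \<longleftrightarrow> (is_path p \<or> is_cycle p) \<and> hd p \<in> V \<and> last p \<in> V \<and>
     set (butlast (tl p)) \<inter> V = {} \<and> trail_edges p \<inter> E = {}"


section \<open>Ear decompositions\<close>

definition union_verts :: "'a list list \<Rightarrow> 'a set" where
  "union_verts Fs = (\<Union>p\<in>set Fs. set p)"

definition union_edges :: "'a list list \<Rightarrow> 'a set set" where
  "union_edges Fs = (\<Union>p\<in>set Fs. trail_edges p)"

definition ear_decomposition :: "'a set \<Rightarrow> 'a set set \<Rightarrow> 'a list list \<Rightarrow> bool" where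
  "ear_decomposition V E Fs \<longleftrightarrow>
     Fs \<noteq> [] \<and> is_cycle (Fs ! 0) \<and>
     (\<forall>i. 1 \<le> i \<and> i < length Fs \<longrightarrow>
        is_ear (union_verts (take i Fs)) (union_edges (take i Fs)) (Fs ! i)) \<and>
     union_verts Fs = V \<and> union_edges Fs = E"

definition num_even_ears :: "'a list list \<Rightarrow> nat" where
  "num_even_ears Fs = length (filter (\<lambda>p. even (num_edges p)) Fs)"

definition starts_with_odd_cycle :: "'a list list \<Rightarrow> bool" where
  "starts_with_odd_cycle Fs \<longleftrightarrow> odd (num_edges (Fs ! 0))"

text \<open>The following two minima are meaningful only if some ear decomposition of the required
  kind exists; otherwise \<open>LEAST\<close> yields an unspecified number.\<close>

definition phi :: "'a set \<Rightarrow> 'a set set \<Rightarrow> nat" where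
  "phi V E = (LEAST k. \<exists>Fs. ear_decomposition V E Fs \<and> num_even_ears Fs = k)"

definition phi_odd :: "'a set \<Rightarrow> 'a set set \<Rightarrow> nat" where
  "phi_odd V E =
     (LEAST k. \<exists>Fs. ear_decomposition V E Fs \<and> starts_with_odd_cycle Fs \<and> num_even_ears Fs = k)"

definition optimal_ear_decomposition :: "'a set \<Rightarrow> 'a set set \<Rightarrow> 'a list list \<Rightarrow> bool" where
  "optimal_ear_decomposition V E Fs \<longleftrightarrow> ear_decomposition V E Fs \<and> num_even_ears Fs = phi V E"

end

theory Submission
  imports Defs
begin

text \<open>
  Let \<open>H\<close> be built from one vertex by a sequence of ears, \<open>e\<close> of them even, and let \<open>u\<close>, \<open>v\<close> be
  vertices of \<open>H\<close>. For each parity \<open>p\<close> there is a path \<open>q\<close> in \<open>H\<close> from \<open>u\<close> to \<open>v\<close>, trivial if \<open>u = v\<close>,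
  such that \<open>H\<close> is obtained from \<open>q\<close> by adding ears and such that a further ear \<open>P\<close> from \<open>u\<close> to \<open>v\<close>
  of parity \<open>p\<close> may be exchanged for the cycle \<open>q \<union> P\<close>: that cycle followed by the ears of \<open>H - q\<close>
  has at most as many even members as the \<open>e\<close> even ears together with \<open>P\<close>. This follows by
  induction on the number of ears: if \<open>u\<close> or \<open>v\<close> is interior to the last ear, the last ear is cut
  there, and parity tells which of its pieces should extend \<open>q\<close> and which should be added later.

  In an optimal decomposition of a non-bipartite graph, take for \<open>P\<close> the first ear whose addition
  destroys bipartiteness. Then \<open>q \<union> P\<close> is an odd cycle, and the exchange puts it in front.
\<close>

section \<open>Trails\<close>

lemma trail_edges_simps [simp]:
  "trail_edges [] = {}"
  "trail_edges [x] = {}"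
  "trail_edges (x # y # p) = insert {x, y} (trail_edges (y # p))"
proof -
  show "trail_edges (x # y # p) = insert {x, y} (trail_edges (y # p))"
  proof (intro set_eqI iffI)
    fix e assume "e \<in> trail_edges (x # y # p)"
    then obtain i where "e = {(x # y # p) ! i, (x # y # p) ! Suc i}" "Suc i < length (x # y # p)"
      by (auto simp: trail_edges_def)
    then show "e \<in> insert {x, y} (trail_edges (y # p))"
      by (cases i) (auto simp: trail_edges_def)
  next
    fix e assume "e \<in> insert {x, y} (trail_edges (y # p))"
    then consider "e = {x, y}" | i where "e = {(y # p) ! i, (y # p) ! Suc i}" "Suc i < length (y # p)"
      by (auto simp: trail_edges_def)
    then show "e \<in> trail_edges (x # y # p)"
    proof cases
      case 1
      then show ?thesis unfolding trail_edges_def by (auto intro!: exI[of _ 0])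
    next
      case 2
      then show ?thesis unfolding trail_edges_def by (auto intro!: exI[of _ "Suc i"])
    qed
  qed
qed (auto simp: trail_edges_def)

lemma trail_edges_append:
  "trail_edges (p @ x # q) = trail_edges (p @ [x]) \<union> trail_edges (x # q)"
  by (induction p rule: induct_list012) auto

lemma trail_edges_append_last:
  "p \<noteq> [] \<Longrightarrow> trail_edges (p @ q) = trail_edges p \<union> trail_edges (last p # q)"
  by (metis append.assoc append_Cons append_Nil append_butlast_last_id trail_edges_append)

lemma trail_edges_append_hd:
  "q \<noteq> [] \<Longrightarrow> trail_edges (p @ q) = trail_edges (p @ [hd q]) \<union> trail_edges q"
  using trail_edges_append[of p "hd q" "tl q"] by simp

lemma trail_edges_rev [simp]: "trail_edges (rev p) = trail_edges p"
proof (induction p rule: induct_list012)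
  case (3 x y p)
  then show ?case
    using trail_edges_append[of "rev p" y "[x]"] by (auto simp: insert_commute)
qed auto

lemma trail_edges_subset: "e \<in> trail_edges p \<Longrightarrow> e \<subseteq> set p"
  by (induction p rule: induct_list012) auto

text \<open>Two consecutive vertices both avoid the interior only if the trail is a single edge. As
  interiors of ears are new, this is how edges of different pieces are kept apart.\<close>

lemma trail_edge_meets_interior:
  "e \<in> trail_edges (x # I @ [y]) \<Longrightarrow> e \<inter> set I \<noteq> {} \<or> I = [] \<and> e = {x, y}"
  by (induction I arbitrary: x) auto


section \<open>Ears and sequences of ears\<close>

text \<open>Normal form with the interior exposed. If \<open>x \<noteq> y\<close>, the whole list is
  distinct because \<open>I\<close> avoids \<open>W\<close> and both ends lie in it; if
  \<open>x = y\<close>, two interior vertices give the three edges of a cycle.\<close>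

lemma is_ear_iff:
  "is_ear W D (x # I @ [y]) \<longleftrightarrow> x \<in> W \<and> y \<in> W \<and> distinct I \<and> set I \<inter> W = {} \<and>
     (x \<noteq> y \<or> length I \<ge> 2) \<and> trail_edges (x # I @ [y]) \<inter> D = {}"
  by (auto simp: is_ear_def is_path_def is_cycle_def num_edges_def butlast_append)

lemma is_ear_cases:
  assumes "is_ear W D p"
  obtains x I y where "p = x # I @ [y]"
proof -
  have len: "length p \<ge> 2"
    using assms by (auto simp: is_ear_def is_path_def is_cycle_def num_edges_def)
  then obtain x r where "p = x # r" "r \<noteq> []" by (cases p; cases "tl p") auto
  then have "p = x # butlast r @ [last r]" by simp
  then show ?thesis using that by blast
qed

lemma is_ear_rev: "is_ear W D p \<Longrightarrow> is_ear W D (rev p)"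
proof -
  assume ear: "is_ear W D p"
  then obtain x I y where p: "p = x # I @ [y]" by (rule is_ear_cases)
  have r: "rev p = y # rev I @ [x]" using p by simp
  have "trail_edges (y # rev I @ [x]) = trail_edges p"
    using r trail_edges_rev[of p] by simp
  then show ?thesis using ear unfolding r by (auto simp add: p is_ear_iff)
qed

lemma is_ear_singleton: "is_ear {a} {} p \<longleftrightarrow> is_cycle p \<and> hd p = a"
proof
  assume ear: "is_ear {a} {} p"
  then obtain x I y where p: "p = x # I @ [y]" by (rule is_ear_cases)
  show "is_cycle p \<and> hd p = a"
    using ear unfolding p is_ear_iff by (auto simp: is_cycle_def num_edges_def)
next
  assume cyc: "is_cycle p \<and> hd p = a"
  then obtain r where p: "p = a # r" "r \<noteq> []"
    by (cases p; cases "tl p") (auto simp: is_cycle_def num_edges_def)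
  then obtain I y where r: "r = I @ [y]" by (metis append_butlast_last_id)
  show "is_ear {a} {} p"
    using cyc unfolding p r is_ear_iff by (auto simp: is_cycle_def num_edges_def)
qed

text \<open>The starting graph is a parameter, so one notion serves for whole decompositions
  (starting from a single vertex) and for the ears that rebuild a graph from a path or a
  cycle.\<close>

fun ears :: "'a set \<Rightarrow> 'a set set \<Rightarrow> 'a list list \<Rightarrow> bool" where
  "ears W D [] \<longleftrightarrow> True"
| "ears W D (p # Fs) \<longleftrightarrow> is_ear W D p \<and> ears (W \<union> set p) (D \<union> trail_edges p) Fs"

lemma union_simps [simp]:
  "union_verts [] = {}" "union_verts (p # Fs) = set p \<union> union_verts Fs"
  "union_verts (Fs @ Gs) = union_verts Fs \<union> union_verts Gs"
  "union_edges [] = {}" "union_edges (p # Fs) = trail_edges p \<union> union_edges Fs"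
  "union_edges (Fs @ Gs) = union_edges Fs \<union> union_edges Gs"
  by (auto simp: union_verts_def union_edges_def)

lemma num_even_ears_simps [simp]:
  "num_even_ears [] = 0"
  "num_even_ears (p # Fs) = of_bool (even (num_edges p)) + num_even_ears Fs"
  "num_even_ears (Fs @ Gs) = num_even_ears Fs + num_even_ears Gs"
  by (auto simp: num_even_ears_def)

lemma ears_append:
  "ears W D (Fs @ Gs) \<longleftrightarrow> ears W D Fs \<and> ears (W \<union> union_verts Fs) (D \<union> union_edges Fs) Gs"
  by (induction Fs arbitrary: W D) (auto simp: Un_assoc)

lemma ears_iff_nth:
  "ears W D Fs \<longleftrightarrow> (\<forall>i<length Fs. is_ear (W \<union> union_verts (take i Fs))
     (D \<union> union_edges (take i Fs)) (Fs ! i))"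
  by (induction Fs arbitrary: W D) (simp_all add: All_less_Suc2 Un_assoc)

lemma union_edges_subset: "e \<in> union_edges Fs \<Longrightarrow> e \<subseteq> union_verts Fs"
  using trail_edges_subset by (fastforce simp: union_verts_def union_edges_def)

text \<open>Interiors of the ears avoid \<open>W\<close>, hence also every vertex of
  \<open>X\<close> that occurs in \<open>Fs\<close>. This allows the start to be lengthened by
  pieces of an ear that used to come later.\<close>

lemma ears_enlarge:
  assumes "ears W D Fs" "X \<inter> union_verts Fs \<subseteq> W" "Y \<inter> union_edges Fs = {}"
  shows "ears (W \<union> X) (D \<union> Y) Fs"
  using assms
proof (induction Fs arbitrary: W D)
  case (Cons p Fs)
  obtain x I y where p: "p = x # I @ [y]"
    using Cons.prems(1) is_ear_cases by (metis ears.simps(2))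
  have "is_ear (W \<union> X) (D \<union> Y) p"
    using Cons.prems unfolding p by (simp add: is_ear_iff) blast
  moreover have "ears ((W \<union> set p) \<union> X) ((D \<union> trail_edges p) \<union> Y) Fs"
    using Cons.prems by (intro Cons.IH) auto
  ultimately show ?case by (simp add: Un_ac)
qed simp

text \<open>\<open>F\<^sub>0\<close> is a closed ear added to the one-vertex graph.\<close>

lemma ear_decomposition_iff:
  "ear_decomposition V E Fs \<longleftrightarrow> Fs \<noteq> [] \<and> ears {hd (hd Fs)} {} Fs \<and>
     union_verts Fs = V \<and> union_edges Fs = E"
proof (cases Fs)
  case (Cons p Gs)
  have ne: "insert (hd p) (set p) = set p" if "is_cycle p"
    using that by (cases p) (auto simp: is_cycle_def num_edges_def)
  have shift: "(\<forall>i. 1 \<le> i \<and> i < Suc n \<longrightarrow> Q i) \<longleftrightarrow> (\<forall>i<n. Q (Suc i))" for n and Q :: "nat \<Rightarrow> bool"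
    by (metis Suc_le_D Suc_less_eq One_nat_def Suc_le_mono le0)
  have "(\<forall>i. 1 \<le> i \<and> i < length Fs \<longrightarrow>
        is_ear (union_verts (take i Fs)) (union_edges (take i Fs)) (Fs ! i))
      \<longleftrightarrow> (\<forall>i<length Gs. is_ear (union_verts (take (Suc i) Fs)) (union_edges (take (Suc i) Fs)) (Gs ! i))"
    unfolding Cons
    by (simp only: list.size(4) add_Suc_right add_0_right One_nat_def
        shift[unfolded One_nat_def] nth_Cons_Suc)
  also have "\<dots> \<longleftrightarrow> ears (set p) (trail_edges p) Gs"
    unfolding ears_iff_nth Cons by simp
  finally show ?thesis
    using ne by (auto simp: ear_decomposition_def Cons is_ear_singleton)
qed (simp add: ear_decomposition_def)


section \<open>Growing a graph from a path\<close>

text \<open>In \<open>path_dec W D k p u v\<close>, \<open>p\<close> stands for the length of an ear from \<open>u\<close> to \<open>v\<close> still to be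
  added to \<open>(W, D)\<close>; keeping only its length lets the induction replace it by longer ones.\<close>

definition path_dec :: "'a set \<Rightarrow> 'a set set \<Rightarrow> nat \<Rightarrow> nat \<Rightarrow> 'a \<Rightarrow> 'a \<Rightarrow> bool" where
  "path_dec W D k p u v \<longleftrightarrow> (\<exists>q Fs. q \<noteq> [] \<and> hd q = u \<and> last q = v \<and> distinct q \<and>
     ears (set q) (trail_edges q) Fs \<and> set q \<union> union_verts Fs = W \<and>
     trail_edges q \<union> union_edges Fs = D \<and>
     of_bool (even (num_edges q + p)) + num_even_ears Fs \<le> k + of_bool (even p))"

lemma path_dec_sym: "path_dec W D k p u v \<Longrightarrow> path_dec W D k p v u"
proof -
  assume "path_dec W D k p u v"
  then obtain q Fs where "q \<noteq> [] \<and> hd q = u \<and> last q = v \<and> distinct q \<and>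
     ears (set q) (trail_edges q) Fs \<and> set q \<union> union_verts Fs = W \<and>
     trail_edges q \<union> union_edges Fs = D \<and>
     of_bool (even (num_edges q + p)) + num_even_ears Fs \<le> k + of_bool (even p)"
    unfolding path_dec_def by blast
  then show ?thesis
    unfolding path_dec_def
    by (intro exI[of _ "rev q"] exI[of _ Fs]) (auto simp: hd_rev last_rev num_edges_def)
qed

lemma path_dec_base: "path_dec {a} {} 0 p a a"
  unfolding path_dec_def by (intro exI[of _ "[a]"] exI[of _ "[]"]) (auto simp: num_edges_def)

section \<open>One more ear, with the ends of the path in any position\<close>

lemma path_dec_add_ear:
  assumes "path_dec W D k p u v" "is_ear W D F"
  shows "path_dec (W \<union> set F) (D \<union> trail_edges F) (k + of_bool (even (num_edges F))) p u v"
proof -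
  obtain q Fs where "q \<noteq> [] \<and> hd q = u \<and> last q = v \<and> distinct q \<and>
     ears (set q) (trail_edges q) Fs \<and> set q \<union> union_verts Fs = W \<and>
     trail_edges q \<union> union_edges Fs = D \<and>
     of_bool (even (num_edges q + p)) + num_even_ears Fs \<le> k + of_bool (even p)"
    using assms(1) unfolding path_dec_def by blast
  then show ?thesis
    using assms(2) unfolding path_dec_def
    by (intro exI[of _ q] exI[of _ "Fs @ [F]"]) (auto simp: ears_append)
qed

text \<open>The piece of the ear between \<open>u\<close> and \<open>x\<close> is prepended to the
  path from \<open>x\<close> to \<open>v\<close>; the piece from \<open>u\<close> to
  \<open>y\<close> becomes the last ear. An ear of length \<open>p\<close> at \<open>u\<close> thus
  acts like one of length \<open>Suc (length I) + p\<close> at \<open>x\<close>. The hypothesis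
  \<open>le\<close> leaves the choice of the extending piece to the caller.\<close>

lemma path_dec_split_once:
  assumes ear: "is_ear W D (x # I @ u # J @ [y])" and "v \<in> W"
    and dec: "path_dec W D k (Suc (length I) + p) x v"
    and le: "k + of_bool (even (Suc (length I) + p)) + of_bool (even (Suc (length J)))
      \<le> k' + of_bool (even p)"
  shows "path_dec (W \<union> set (x # I @ u # J @ [y])) (D \<union> trail_edges (x # I @ u # J @ [y])) k' p u v"
proof -
  obtain q Fs where q: "q \<noteq> []" "hd q = x" "last q = v" "distinct q"
    and Fs: "ears (set q) (trail_edges q) Fs" and W: "set q \<union> union_verts Fs = W"
    and D: "trail_edges q \<union> union_edges Fs = D"
    and cnt: "of_bool (even (num_edges q + (Suc (length I) + p))) + num_even_ears Fs
      \<le> k + of_bool (even (Suc (length I) + p))"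
    using dec unfolding path_dec_def by blast
  define A where "A = trail_edges (x # I @ [u])"
  define B where "B = trail_edges (u # J @ [y])"
  have F: "trail_edges (x # I @ u # J @ [y]) = A \<union> B"
    using trail_edges_append[of "x # I" u "J @ [y]"] by (simp add: A_def B_def)
  have "is_ear W D (x # (I @ u # J) @ [y])" using ear by simp
  note ear' = this[unfolded is_ear_iff]
  \<comment> \<open>A common edge would have to be all of both pieces, so the ear would be closed
    with \<open>u\<close> as its only interior vertex.\<close>
  have AB: "A \<inter> B = {}"
  proof (rule ccontr)
    assume "A \<inter> B \<noteq> {}"
    then obtain e where e: "e \<in> A" "e \<in> B" by blast
    have "e \<subseteq> {x, u} \<union> set I" "e \<subseteq> {u, y} \<union> set J"
      using e trail_edges_subset by (fastforce simp: A_def B_def)+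
    moreover have "e \<inter> set I \<noteq> {} \<or> I = [] \<and> e = {x, u}" "e \<inter> set J \<noteq> {} \<or> J = [] \<and> e = {u, y}"
      using e[unfolded A_def B_def, THEN trail_edge_meets_interior] by simp_all
    ultimately show False using ear' by (auto simp: doubleton_eq_iff)
  qed
  define R where "R = u # rev I @ q"
  have R: "trail_edges R = A \<union> trail_edges q"
    using trail_edges_append_hd[of q "u # rev I"] q trail_edges_rev[of "x # I @ [u]"]
    by (simp add: R_def A_def)
  have D_disj: "(A \<union> B) \<inter> D = {}" using ear' F by auto
  have "ears (set q \<union> ({u} \<union> set I)) (trail_edges q \<union> A) Fs"
    using ear' W D D_disj by (intro ears_enlarge[OF Fs]) auto
  moreover have "set R = set q \<union> ({u} \<union> set I)" by (auto simp: R_def)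
  ultimately have "ears (set R) (trail_edges R) Fs" by (simp add: R Un_commute)
  moreover have "is_ear (set R \<union> union_verts Fs) (trail_edges R \<union> union_edges Fs) (u # J @ [y])"
    unfolding is_ear_iff R B_def[symmetric] using ear' W D D_disj AB by (auto simp: R_def)
  ultimately have "ears (set R) (trail_edges R) (Fs @ [u # J @ [y]])"
    by (simp add: ears_append)
  moreover have "distinct R" using q ear' W by (auto simp: R_def)
  moreover have "set R \<union> union_verts (Fs @ [u # J @ [y]]) = W \<union> set (x # I @ u # J @ [y])"
    using W q(1,2) by (auto simp: R_def)
  moreover have "trail_edges R \<union> union_edges (Fs @ [u # J @ [y]])
      = D \<union> trail_edges (x # I @ u # J @ [y])"
    using D by (auto simp: R F B_def)
  moreover have "num_edges R = num_edges q + Suc (length I)"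
    using q(1) by (cases q) (auto simp: num_edges_def R_def)
  moreover have "of_bool (even (num_edges q + Suc (length I) + p)) + num_even_ears (Fs @ [u # J @ [y]])
      \<le> k' + of_bool (even p)"
    using cnt le by (simp add: num_edges_def add.assoc)
  ultimately show ?thesis
    using q unfolding path_dec_def
    by (intro exI[of _ R] exI[of _ "Fs @ [u # J @ [y]]"]) (auto simp: R_def)
qed

text \<open>The segment \<open>M\<close> and the detour through the old graph both lead from
  \<open>u\<close> to \<open>v\<close>. One of them becomes the initial path and the other an ear;
  parity decides which. If \<open>u = v\<close>, then \<open>M\<close> is a single vertex and the
  detour is a closed ear.\<close>

lemma path_dec_split_twice:
  assumes ear: "is_ear W D (x # I @ M @ J @ [y])" and M: "M \<noteq> []" "hd M = u" "last M = v"
    and dec: "\<And>p. path_dec W D k p x y"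
  shows "path_dec (W \<union> set (x # I @ M @ J @ [y])) (D \<union> trail_edges (x # I @ M @ J @ [y]))
    (k + of_bool (even (num_edges (x # I @ M @ J @ [y])))) p u v" (is "path_dec ?W ?D ?k p u v")
proof -
  \<comment> \<open>\<open>s\<close> counts the edges of the ear outside \<open>M\<close>, so the
    ear has \<open>s + m\<close> edges.\<close>
  define s where "s = length I + length J + 2"
  define m where "m = num_edges M"
  have k_eq: "?k = k + of_bool (even (s + m))"
    using M(1) by (cases M) (auto simp: s_def m_def num_edges_def)
  define A where "A = trail_edges (x # I @ [u])"
  define B where "B = trail_edges (v # J @ [y])"
  define C where "C = trail_edges M"
  have F: "trail_edges (x # I @ M @ J @ [y]) = A \<union> C \<union> B"
    using trail_edges_append_hd[of "M @ J @ [y]" "x # I"] trail_edges_append_last[of M "J @ [y]"] M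
    by (simp add: A_def B_def C_def Un_assoc)
  have "is_ear W D (x # (I @ M @ J) @ [y])" using ear by simp
  note ear' = this[unfolded is_ear_iff]
  have D_disj: "(A \<union> C \<union> B) \<inter> D = {}" using ear' F by auto
  have uv: "u \<in> set M" "v \<in> set M" using M by auto
  have M_single: "M = [u]" if "u = v"
  proof (cases M)
    case (Cons a M')
    then show ?thesis using that M ear' by (cases "M' = []") auto
  qed (use M in simp)
  have M_split: "M = u # butlast (tl M) @ [v]" if "u \<noteq> v"
    using that M by (cases M) (auto split: if_splits)
  \<comment> \<open>In the graph enlarged by the ear, the union of \<open>M\<close> and a path through the old part is a cycle;
    either of these two paths may serve as the initial one.\<close>
  define R where "R = (\<lambda>q. u # (rev I @ q @ rev J) @ [v])"
  have R: "trail_edges (R q) = A \<union> trail_edges q \<union> B" "trail_edges (R q) \<inter> C = {}"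
      "is_ear (set M) C (R q)" "num_edges (R q) = num_edges q + s"
      "set (R q) = set q \<union> set I \<union> set J \<union> {u, v}"
      "distinct (rev I @ q @ rev J)"
    if q: "q \<noteq> []" "hd q = x" "last q = y" "distinct q" "set q \<subseteq> W" for q
  proof -
    show "trail_edges (R q) = A \<union> trail_edges q \<union> B"
      using trail_edges_append_hd[of "q @ rev J @ [v]" "u # rev I"]
        trail_edges_append_last[of q "rev J @ [v]"] q
        trail_edges_rev[of "x # I @ [u]"] trail_edges_rev[of "v # J @ [y]"]
      by (simp add: R_def A_def B_def Un_assoc)
    show disj: "trail_edges (R q) \<inter> C = {}"
    proof (rule ccontr)
      assume "trail_edges (R q) \<inter> C \<noteq> {}"
      then obtain e where e: "e \<in> trail_edges (R q)" "e \<in> C" by blast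
      have "e \<inter> set (rev I @ q @ rev J) \<noteq> {}"
        using e(1) trail_edge_meets_interior[of e u "rev I @ q @ rev J" v] q(1)
        by (auto simp: R_def)
      moreover have "e \<subseteq> set M" using e(2) trail_edges_subset by (auto simp: C_def)
      ultimately show False using ear' q by auto
    qed
    show dist: "distinct (rev I @ q @ rev J)" using ear' q by auto
    \<comment> \<open>If the detour had only one interior vertex, that vertex would be
      \<open>x = y\<close>, and the given ear would be closed with \<open>u\<close> as its only
      interior vertex.\<close>
    have "length (rev I @ q @ rev J) \<ge> 2" if "u = v"
    proof (rule ccontr)
      assume short: "\<not> length (rev I @ q @ rev J) \<ge> 2"
      have "length q \<ge> 1" using q(1) by (simp add: Suc_le_eq)
      then have "length I = 0 \<and> length J = 0 \<and> length q = 1"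
        using short by (simp only: length_append length_rev) linarith
      then have "I = []" "J = []" "x = y" using q by (auto simp: length_Suc_conv)
      then show False using M_single[OF that] ear' by auto
    qed
    moreover have "set (rev I @ q @ rev J) \<inter> set M = {}" using ear' q by auto
    ultimately show "is_ear (set M) C (R q)"
      using uv dist disj unfolding R_def is_ear_iff by blast
    show "num_edges (R q) = num_edges q + s"
      using q(1) by (cases q) (auto simp: num_edges_def R_def s_def)
    show "set (R q) = set q \<union> set I \<union> set J \<union> {u, v}" by (auto simp: R_def)
  qed
  have enlarge: "ears (set (R q) \<union> set M) (trail_edges (R q) \<union> C) Fs"
      "ears (set (R q)) (trail_edges (R q)) Fs"
    if q: "q \<noteq> []" "hd q = x" "last q = y" "distinct q" and Fs: "ears (set q) (trail_edges q) Fs"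
      and W: "set q \<union> union_verts Fs = W" and D: "trail_edges q \<union> union_edges Fs = D" for q Fs
  proof -
    have qW: "set q \<subseteq> W" using W by blast
    have "ears (set q \<union> (set I \<union> set J \<union> set M)) (trail_edges q \<union> (A \<union> B \<union> C)) Fs"
      using ear' W D D_disj by (intro ears_enlarge[OF Fs]) auto
    moreover have "set q \<union> (set I \<union> set J \<union> set M) = set (R q) \<union> set M"
      using R(5)[OF q qW] uv by auto
    moreover have "trail_edges q \<union> (A \<union> B \<union> C) = trail_edges (R q) \<union> C"
      using R(1)[OF q qW] by auto
    ultimately show "ears (set (R q) \<union> set M) (trail_edges (R q) \<union> C) Fs" by simp
    have "ears (set q \<union> (set I \<union> set J \<union> {u, v})) (trail_edges q \<union> (A \<union> B)) Fs"
      using ear' W D D_disj uv by (intro ears_enlarge[OF Fs]) auto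
    moreover have "set q \<union> (set I \<union> set J \<union> {u, v}) = set (R q)"
      using R(5)[OF q qW] by auto
    moreover have "trail_edges q \<union> (A \<union> B) = trail_edges (R q)"
      using R(1)[OF q qW] by auto
    ultimately show "ears (set (R q)) (trail_edges (R q)) Fs" by simp
  qed
  show ?thesis
  \<comment> \<open>In the first case \<open>R q\<close> is the initial path and \<open>M\<close> is
    added last. An ear of length \<open>p\<close> closing \<open>R q\<close> acts on
    \<open>q\<close> like one of length \<open>s + p\<close>, which is the value given to
    \<open>dec\<close>; the inequality says that the parity of \<open>M\<close> can then be
    afforded.\<close>
  proof (cases "u \<noteq> v \<and> of_bool (even (s + p)) + of_bool (even m)
      \<le> (of_bool (even (s + m)) + of_bool (even p) :: nat)")
    case True
    obtain q Fs where q: "q \<noteq> []" "hd q = x" "last q = y" "distinct q"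
      and Fs: "ears (set q) (trail_edges q) Fs" and W: "set q \<union> union_verts Fs = W"
      and D: "trail_edges q \<union> union_edges Fs = D"
      and cnt: "of_bool (even (num_edges q + (s + p))) + num_even_ears Fs \<le> k + of_bool (even (s + p))"
      using dec[of "s + p"] unfolding path_dec_def by blast
    have qW: "set q \<subseteq> W" using W by blast
    note R = R[OF q qW]
    have M_eq: "M = u # butlast (tl M) @ [v]" using True M_split by blast
    have dM: "distinct (u # butlast (tl M) @ [v])"
      using M_eq ear' by (metis distinct_append)
    have "set (butlast (tl M)) \<subseteq> set M" using M_eq by (metis set_subset_Cons set_append Un_upper1 subset_trans)
    then have "set (butlast (tl M)) \<inter> (set (R q) \<union> union_verts Fs) = {}"
      using ear' dM W unfolding R(5) by auto
    moreover have "trail_edges (u # butlast (tl M) @ [v]) \<inter> (trail_edges (R q) \<union> union_edges Fs) = {}"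
      using R(2) D_disj D unfolding M_eq[symmetric] C_def[symmetric] by auto
    ultimately have "is_ear (set (R q) \<union> union_verts Fs) (trail_edges (R q) \<union> union_edges Fs)
        (u # butlast (tl M) @ [v])"
      unfolding is_ear_iff using dM True R(5) by simp
    then have "ears (set (R q)) (trail_edges (R q)) (Fs @ [M])"
      using enlarge(2)[OF q Fs W D] M_eq by (simp add: ears_append)
    moreover have "distinct (R q)"
      using R(6) ear' uv qW True unfolding R_def by auto
    moreover have "set (R q) \<union> union_verts (Fs @ [M]) = ?W"
      using W q(1-3) uv ear' unfolding R(5) by auto
    moreover have "trail_edges (R q) \<union> union_edges (Fs @ [M]) = ?D"
      using D unfolding F R(1) by (auto simp: C_def)
    moreover have "of_bool (even (num_edges (R q) + p)) + num_even_ears (Fs @ [M]) \<le> ?k + of_bool (even p)"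
      using cnt True unfolding R(4) k_eq by (simp add: m_def[symmetric] add.assoc)
    ultimately show ?thesis
      unfolding path_dec_def
      by (intro exI[of _ "R q"] exI[of _ "Fs @ [M]"]) (simp add: R_def)
  next
    case False
    \<comment> \<open>Now \<open>M\<close> is the initial path and \<open>R q\<close> the first ear
      over it. It has \<open>num_edges q + s\<close> edges, so the bound for length \<open>s\<close>
      counts exactly this ear.\<close>
    obtain q Fs where q: "q \<noteq> []" "hd q = x" "last q = y" "distinct q"
      and Fs: "ears (set q) (trail_edges q) Fs" and W: "set q \<union> union_verts Fs = W"
      and D: "trail_edges q \<union> union_edges Fs = D"
      and cnt: "of_bool (even (num_edges q + s)) + num_even_ears Fs \<le> k + of_bool (even s)"
      using dec[of s] unfolding path_dec_def by blast
    have qW: "set q \<subseteq> W" using W by blast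
    note R = R[OF q qW]
    have "m = 0" if "u = v" using M_single[OF that] by (simp add: m_def num_edges_def)
    \<comment> \<open>For \<open>u = v\<close> both sides agree because \<open>m = 0\<close>.
      Otherwise the failed inequality forces \<open>s\<close> and \<open>p\<close> odd and
      \<open>m\<close> even, and then the left side is \<open>0\<close>.\<close>
    then have "of_bool (even (m + p)) + of_bool (even s)
        \<le> (of_bool (even (s + m)) + of_bool (even p) :: nat)"
      using False by (cases "u = v"; cases "even s"; cases "even m"; cases "even p"; simp)
    then have "of_bool (even (num_edges M + p)) + num_even_ears (R q # Fs) \<le> ?k + of_bool (even p)"
      using cnt unfolding k_eq by (simp add: m_def[symmetric] R(4))
    moreover have "ears (set M) (trail_edges M) (R q # Fs)"
      using R(3) enlarge(1)[OF q Fs W D] by (simp add: C_def Un_commute)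
    moreover have "set M \<union> union_verts (R q # Fs) = ?W"
      using W q(1-3) uv ear' by (auto simp: R(5))
    moreover have "trail_edges M \<union> union_edges (R q # Fs) = ?D"
      using D unfolding F by (auto simp: C_def R(1))
    moreover have "distinct M" using ear' by simp
    ultimately show ?thesis
      unfolding path_dec_def using M by blast
  qed
qed

lemma list_between:
  assumes "u \<in> set xs" "v \<in> set xs"
  obtains as m bs where "xs = as @ m @ bs" "m \<noteq> []" "hd m = u \<and> last m = v \<or> hd m = v \<and> last m = u"
proof -
  obtain as bs where xs: "xs = as @ u # bs" using assms(1) by (meson split_list)
  show ?thesis
  proof (cases "v \<in> set as")
    case True
    then obtain cs ds where "as = cs @ v # ds" by (meson split_list)
    then show ?thesis using that[of cs "v # ds @ [u]" bs] xs by simp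
  next
    case False
    then have "v \<in> set (u # bs)" using assms(2) xs by auto
    then obtain cs ds where "u # bs = cs @ v # ds" by (meson split_list)
    then show ?thesis using that[of as "cs @ [v]" ds] xs by (cases cs) auto
  qed
qed

text \<open>Induction step, by the number of ends interior to \<open>F\<close>: the ear is appended
  whole, cut once, or cut at both ends.\<close>

lemma path_dec_extend:
  assumes dec: "\<And>p u v. u \<in> W \<Longrightarrow> v \<in> W \<Longrightarrow> path_dec W D k p u v"
    and ear: "is_ear W D F" and uv: "u \<in> W \<union> set F" "v \<in> W \<union> set F"
  shows "path_dec (W \<union> set F) (D \<union> trail_edges F) (k + of_bool (even (num_edges F))) p u v"
    (is "path_dec ?W ?D ?k p u v")
proof -
  obtain x I y where F: "F = x # I @ [y]" using ear is_ear_cases by blast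
  have xy: "x \<in> W" "y \<in> W" using ear by (auto simp: F is_ear_iff)
  have once: "path_dec ?W ?D ?k p u v" if uI: "u \<in> set I" and vW: "v \<in> W" for u v
  proof -
    obtain A B where I: "I = A @ u # B" using uI by (meson split_list)
    have F': "F = x # A @ u # B @ [y]" using F I by simp
    have rF: "rev F = y # rev B @ u # rev A @ [x]" using F' by simp
    have k: "?k = k + of_bool (even (Suc (length A) + Suc (length B)))" by (simp add: F' num_edges_def)
    \<comment> \<open>Let the pieces have \<open>a\<close> and \<open>b\<close> edges. Extending the
      path by the first one is too costly only if \<open>a\<close> and \<open>p\<close> are odd and
      \<open>b\<close> is even; in that case extending it by the second one works. The second
      alternative is the first for the reversed ear.\<close>
    consider "of_bool (even (Suc (length A) + p)) + of_bool (even (Suc (length B)))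
        \<le> (of_bool (even (Suc (length A) + Suc (length B))) + of_bool (even p) :: nat)"
      | "of_bool (even (Suc (length (rev B)) + p)) + of_bool (even (Suc (length (rev A))))
        \<le> (of_bool (even (Suc (length A) + Suc (length B))) + of_bool (even p) :: nat)"
      by (cases "even (length A)"; cases "even (length B)"; cases "even p"; simp)
    then show ?thesis
    proof cases
      case 1
      then show ?thesis
        using path_dec_split_once[OF ear[unfolded F'] vW dec[OF xy(1) vW], of p ?k]
        unfolding k F'[symmetric] by linarith
    next
      case 2
      have ear': "is_ear W D (y # rev B @ u # rev A @ [x])" using is_ear_rev[OF ear] rF by simp
      show ?thesis
        using 2 path_dec_split_once[OF ear' vW dec[OF xy(2) vW], of p ?k]
        unfolding k rF[symmetric] by (simp only: set_rev trail_edges_rev)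
    qed
  qed
  consider "u \<in> W" "v \<in> W" | "u \<in> set I" "v \<in> W" | "u \<in> W" "v \<in> set I" | "u \<in> set I" "v \<in> set I"
    using uv xy F by auto
  then show ?thesis
  proof cases
    case 1
    then show ?thesis using path_dec_add_ear[OF dec ear] by blast
  next
    case 2
    then show ?thesis by (rule once)
  next
    case 3
    then show ?thesis by (intro path_dec_sym[OF once])
  next
    case 4
    then obtain A M B where I: "I = A @ M @ B" and M: "M \<noteq> []"
      and ends: "hd M = u \<and> last M = v \<or> hd M = v \<and> last M = u"
      by (rule list_between)
    have F': "F = x # A @ M @ B @ [y]" using F I by simp
    have *: "path_dec ?W ?D ?k p (hd M) (last M)"
      using path_dec_split_twice[OF ear[unfolded F'] M refl refl dec[OF xy]] unfolding F'[symmetric] .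
    then show ?thesis using ends path_dec_sym[OF *] by auto
  qed
qed

text \<open>The ends and \<open>p\<close> stay arbitrary in the induction, since cutting the last
  ear moves the ends into the old graph and changes the length of the ear still to come.\<close>

lemma ears_imp_path_dec:
  assumes "ears {a} {} Fs" "u \<in> {a} \<union> union_verts Fs" "v \<in> {a} \<union> union_verts Fs"
  shows "path_dec ({a} \<union> union_verts Fs) (union_edges Fs) (num_even_ears Fs) p u v"
  using assms
proof (induction Fs arbitrary: p u v rule: rev_induct)
  case Nil
  then show ?case using path_dec_base by simp
next
  case (snoc F Fs)
  then have "path_dec (({a} \<union> union_verts Fs) \<union> set F) (union_edges Fs \<union> trail_edges F)
      (num_even_ears Fs + of_bool (even (num_edges F))) p u v"
    by (intro path_dec_extend) (simp_all add: ears_append)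
  then show ?case by (simp add: Un_assoc)
qed


section \<open>Two-colourings\<close>

definition two_col :: "('a \<Rightarrow> bool) \<Rightarrow> 'a set set \<Rightarrow> bool" where
  "two_col c D \<longleftrightarrow> (\<forall>x y. {x, y} \<in> D \<longrightarrow> c x \<noteq> c y)"

lemma two_col_trail:
  assumes "two_col c D" "trail_edges q \<subseteq> D" "q \<noteq> []"
  shows "c (hd q) = c (last q) \<longleftrightarrow> even (num_edges q)"
  using assms
  by (induction q rule: induct_list012) (auto simp: two_col_def num_edges_def)

text \<open>The interior is coloured alternately from \<open>x\<close> on; the parity condition
  makes the edge at \<open>y\<close> proper. New vertices meet no edge of \<open>D\<close>, so
  recolouring them does no harm.\<close>

lemma two_col_add_ear:
  assumes "two_col c D" "D \<subseteq> Pow W" "x \<in> W" "y \<in> W" "distinct I" "set I \<inter> W = {}"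
    and "c x = c y \<longleftrightarrow> even (Suc (length I))"
  shows "\<exists>c. two_col c (D \<union> trail_edges (x # I @ [y]))"
  using assms
proof (induction I arbitrary: x W D c)
  case Nil
  then show ?case by (auto simp: two_col_def doubleton_eq_iff intro!: exI[of _ c])
next
  case (Cons i I)
  have "i \<notin> W" using Cons.prems by auto
  have "c z \<noteq> c w" if "{z, w} \<in> D" for z w
    using that Cons.prems by (auto simp: two_col_def)
  moreover have "z \<noteq> i \<and> w \<noteq> i" if "{z, w} \<in> D" for z w
    using that Cons.prems(2) \<open>i \<notin> W\<close> by auto
  moreover have "x \<noteq> i" using \<open>i \<notin> W\<close> Cons.prems by auto
  ultimately have col: "two_col (c(i := \<not> c x)) (insert {x, i} D)"
    by (auto simp: two_col_def doubleton_eq_iff)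
  have "\<exists>c. two_col c (insert {x, i} D \<union> trail_edges (i # I @ [y]))"
    by (rule Cons.IH[OF col, of "insert i W"]) (use Cons.prems \<open>i \<notin> W\<close> in auto)
  then show ?case by simp
qed

lemma two_col_imp_bipartite:
  assumes "simple_graph V E" "two_col c E"
  shows "bipartite V E"
proof -
  have "\<exists>a\<in>{v \<in> V. c v}. \<exists>b\<in>{v \<in> V. \<not> c v}. e = {a, b}" if e: "e \<in> E" for e
  proof -
    obtain x y where xy: "e = {x, y}"
      using assms(1) e by (auto simp: simple_graph_def card_2_iff)
    then have "x \<in> V" "y \<in> V" "c x \<noteq> c y"
      using assms e by (auto simp: simple_graph_def two_col_def)
    then show ?thesis using xy by (cases "c x") (auto simp: insert_commute)
  qed
  then show ?thesis
    unfolding bipartite_def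
    by (intro exI[of _ "{v \<in> V. c v}"] exI[of _ "{v \<in> V. \<not> c v}"]) auto
qed

section \<open>Moving an odd cycle to the front\<close>

lemma first_odd_ear:
  assumes "\<nexists>c. two_col c (union_edges Fs)"
  obtains Xs P Ys where "Fs = Xs @ P # Ys" "\<exists>c. two_col c (union_edges Xs)"
    "\<nexists>c. two_col c (union_edges Xs \<union> trail_edges P)"
proof -
  have "\<exists>Xs P Ys. Fs = Xs @ P # Ys \<and> (\<exists>c. two_col c (union_edges Xs)) \<and>
      (\<nexists>c. two_col c (union_edges Xs \<union> trail_edges P))"
    using assms
  proof (induction Fs rule: rev_induct)
    case Nil
    then show ?case by (simp add: two_col_def)
  next
    case (snoc F Fs)
    show ?case
    proof (cases "\<exists>c. two_col c (union_edges Fs)")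
      case True
      then show ?thesis using snoc.prems by (intro exI[of _ Fs] exI[of _ F] exI[of _ "[]"]) simp
    next
      case False
      then show ?thesis using snoc.IH by (metis append.assoc append_Cons)
    qed
  qed
  then show ?thesis using that by blast
qed

lemma odd_start:
  assumes dec: "ear_decomposition V E Fs" and "simple_graph V E" "\<not> bipartite V E"
  shows "\<exists>Gs. ear_decomposition V E Gs \<and> starts_with_odd_cycle Gs \<and>
    num_even_ears Gs \<le> num_even_ears Fs"
proof -
  define a where "a = hd (hd Fs)"
  have Fs: "ears {a} {} Fs" "union_verts Fs = V" "union_edges Fs = E" "Fs \<noteq> []"
    using dec by (auto simp: ear_decomposition_iff a_def)
  have "\<nexists>c. two_col c (union_edges Fs)"
    using assms two_col_imp_bipartite Fs(3) by metis
  then obtain Xs P Ys where Fs_eq: "Fs = Xs @ P # Ys" and col: "\<exists>c. two_col c (union_edges Xs)"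
    and ncol: "\<nexists>c. two_col c (union_edges Xs \<union> trail_edges P)"
    by (rule first_odd_ear)
  define W where "W = {a} \<union> union_verts Xs"
  define D where "D = union_edges Xs"
  have Xs: "ears {a} {} Xs" and ear: "is_ear W D P"
    and Ys: "ears (W \<union> set P) (D \<union> trail_edges P) Ys"
    using Fs(1) by (simp_all add: Fs_eq ears_append W_def D_def)
  have DW: "D \<subseteq> Pow W" using union_edges_subset by (fastforce simp: D_def W_def)
  have aV: "a \<in> V"
  proof -
    have "is_ear {a} {} (hd Fs)" using Fs(1,4) by (cases Fs) auto
    then have "a \<in> set (hd Fs)" by (metis is_ear_cases a_def list.sel(1) list.set_intros(1))
    then show ?thesis using Fs(2,4) by (cases Fs) auto
  qed
  obtain x I y where P: "P = x # I @ [y]" using ear is_ear_cases by blast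
  note ear' = ear[unfolded P is_ear_iff]
  \<comment> \<open>The ears up to \<open>P\<close> are rearranged so that \<open>P\<close> closes
    the initial path \<open>q\<close> to a cycle.\<close>
  have "path_dec W D (num_even_ears Xs) (num_edges P) x y"
    unfolding W_def D_def using Xs ear' by (intro ears_imp_path_dec) (auto simp: W_def)
  then obtain q Gs where q: "q \<noteq> []" "hd q = x" "last q = y" "distinct q"
    and Gs: "ears (set q) (trail_edges q) Gs" and W: "set q \<union> union_verts Gs = W"
    and D: "trail_edges q \<union> union_edges Gs = D"
    and cnt: "of_bool (even (num_edges q + num_edges P)) + num_even_ears Gs
      \<le> num_even_ears Xs + of_bool (even (num_edges P))"
    unfolding path_dec_def by blast
  obtain c where c: "two_col c D" using col by (auto simp: D_def)
  have "c x = c y \<longleftrightarrow> even (num_edges q)"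
    using two_col_trail[OF c, of q] q D by auto
  \<comment> \<open>The colouring \<open>c\<close> fixes the parity of \<open>q\<close>. If
    \<open>P\<close> had the same parity, \<open>c\<close> would extend over \<open>P\<close>,
    against the choice of \<open>P\<close>.\<close>
  then have odd: "odd (num_edges q + num_edges P)"
    using two_col_add_ear[OF c DW, of x y I] ear' ncol
    by (auto simp: P D_def num_edges_def)
  define C where "C = q @ rev I @ [x]"
  have num_C: "num_edges C = num_edges q + num_edges P"
    using q(1) by (cases q) (auto simp: C_def P num_edges_def)
  have set_C: "set C = set q \<union> set P"
    using q(1-3) by (auto simp: C_def P)
  have edges_C: "trail_edges C = trail_edges q \<union> trail_edges P"
    using trail_edges_append_last[of q "rev I @ [x]"] q trail_edges_rev[of P] by (simp add: C_def P)
  have qW: "set q \<subseteq> W" using W by blast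
  have hd_C: "hd C = x" using q by (simp add: C_def)
  \<comment> \<open>A shorter \<open>C\<close> would come from a closed ear \<open>P\<close> with
    fewer than three edges, or from a one-edge ear \<open>P\<close> parallel to the edge
    \<open>q\<close>, which lies in \<open>D\<close>.\<close>
  have "num_edges C \<ge> 3"
  proof (rule ccontr)
    assume "\<not> num_edges C \<ge> 3"
    then have le: "length q + length I \<le> 2" by (simp add: C_def num_edges_def)
    have "length q \<ge> 1" using q(1) by (simp add: Suc_le_eq)
    then consider "length q = 1" "length I \<le> 1" | "length q = 2" "I = []"
      using le by (cases I) fastforce+
    then show False
    proof cases
      case 1
      then show ?thesis using q ear' by (auto simp: length_Suc_conv)
    next
      case 2
      then have "q = [x, y]" using q by (auto simp: length_Suc_conv numeral_2_eq_2)
      then show ?thesis using ear' D 2 by auto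
    qed
  qed
  moreover have "distinct (tl C)"
    using q ear' qW by (cases q) (auto simp: C_def)
  ultimately have "is_cycle C"
    using hd_C by (simp add: is_cycle_def C_def)
  then have "is_ear {hd C} {} C" by (simp add: is_ear_singleton)
  moreover have "ears (set C) (trail_edges C) Gs"
    unfolding set_C edges_C using ear' W D q(1-3)
    by (intro ears_enlarge[OF Gs]) (auto simp: P)
  moreover have "set C \<union> union_verts Gs = W \<union> set P" "trail_edges C \<union> union_edges Gs = D \<union> trail_edges P"
    using set_C edges_C W D by auto
  moreover have "insert (hd C) (set C) = set C" using hd_C set_C by (auto simp: P)
  ultimately have "ears {hd C} {} (C # Gs @ Ys)"
    using Ys by (simp add: ears_append)
  moreover have "union_verts (C # Gs @ Ys) = V"
    using set_C W Fs(2) aV by (auto simp: Fs_eq W_def)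
  moreover have "union_edges (C # Gs @ Ys) = E"
    using edges_C D Fs(3) by (auto simp: Fs_eq D_def)
  ultimately have "ear_decomposition V E (C # Gs @ Ys)"
    by (simp add: ear_decomposition_iff)
  \<comment> \<open>As \<open>C\<close> is odd, its parity term in \<open>cnt\<close> vanishes:
    \<open>Gs\<close> has no more even members than \<open>Xs\<close> and \<open>P\<close> together,
    and \<open>Ys\<close> is unchanged.\<close>
  moreover have "num_even_ears (C # Gs @ Ys) \<le> num_even_ears Fs"
    using cnt odd by (simp add: num_C Fs_eq)
  moreover have "starts_with_odd_cycle (C # Gs @ Ys)"
    using odd by (simp add: starts_with_odd_cycle_def num_C)
  ultimately show ?thesis by blast
qed


section \<open>Existence of ear decompositions\<close>

text \<open>A walk is shortened to a path stopped at its first vertex in \<open>W\<close>, so that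
  all vertices before the last can be interior to an ear. Going backwards along the walk, a repeated
  vertex cuts off the loop.\<close>

lemma joined_path_into:
  assumes "joined R y x" "x \<in> W"
  obtains p where "p \<noteq> []" "hd p = y" "last p \<in> W" "set (butlast p) \<inter> W = {}" "distinct p"
    "trail_edges p \<subseteq> R"
proof -
  have "(y, x) \<in> {(x, y). {x, y} \<in> R}\<^sup>*" using assms(1) by (simp add: joined_def)
  then have "\<exists>p. p \<noteq> [] \<and> hd p = y \<and> last p \<in> W \<and> set (butlast p) \<inter> W = {} \<and> distinct p \<and>
    trail_edges p \<subseteq> R"
  proof (induction rule: converse_rtrancl_induct)
    case base
    then show ?case using assms(2) by (intro exI[of _ "[x]"]) auto
  next
    case (step y z)
    then obtain p where p: "p \<noteq> []" "hd p = z" "last p \<in> W" "set (butlast p) \<inter> W = {}"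
      "distinct p" "trail_edges p \<subseteq> R"
      by blast
    consider "y \<in> W" | "y \<notin> W" "y \<in> set p" | "y \<notin> W" "y \<notin> set p" by blast
    then show ?case
    proof cases
      case 1
      then show ?thesis by (intro exI[of _ "[y]"]) auto
    next
      case 2
      then obtain a b where ab: "p = a @ y # b" by (meson split_list)
      then show ?thesis
        using p trail_edges_append[of a y b]
        by (intro exI[of _ "y # b"]) (auto simp: butlast_append split: if_splits)
    next
      case 3
      obtain r where r: "p = z # r" using p by (cases p) auto
      then show ?thesis
        using p 3 step.hyps by (intro exI[of _ "y # p"]) auto
    qed
  qed
  then show ?thesis using that by blast
qed

text \<open>A missing edge inside \<open>W\<close> is an ear by itself. Otherwise some edge leaves
  \<open>W\<close>; it is no bridge, so a path avoiding it leads from its outer end back to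
  \<open>W\<close>.\<close>

lemma exists_new_ear:
  assumes G: "simple_graph V E" "two_edge_connected V E"
    and W: "W \<noteq> {}" "W \<subseteq> V" "D \<subseteq> E" "D \<subseteq> Pow W" and new: "D \<noteq> E \<or> W \<noteq> V"
  obtains p where "is_ear W D p" "set p \<subseteq> V" "trail_edges p \<subseteq> E"
proof -
  have joined: "joined E u v" if "u \<in> V" "v \<in> V" for u v
    using G(2) that by (auto simp: two_edge_connected_def graph_connected_def)
  have joined_del: "joined (E - {e}) u v" if "u \<in> V" "v \<in> V" "e \<in> E" for u v e
    using G(2) that joined by (auto simp: two_edge_connected_def bridge_def)
  have E_sub: "\<And>e. e \<in> E \<Longrightarrow> e \<subseteq> V" using G(1) by (auto simp: simple_graph_def)
  show ?thesis
  proof (cases "\<exists>e\<in>E - D. e \<subseteq> W")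
    case True
    then obtain e where e: "e \<in> E" "e \<notin> D" "e \<subseteq> W" by blast
    then obtain x y where xy: "e = {x, y}" "x \<noteq> y"
      using G(1) by (auto simp: simple_graph_def card_2_iff)
    have "is_ear W D (x # [] @ [y])" unfolding is_ear_iff using e xy by auto
    then show ?thesis using that[of "[x, y]"] e xy W by auto
  next
    case False
    have "\<exists>x\<in>W. \<exists>y\<in>V - W. {x, y} \<in> E"
    proof -
      have "W \<noteq> V" using new False E_sub W by blast
      then obtain z w where z: "z \<in> V" "z \<notin> W" "w \<in> W" using W by blast
      then have "joined E z w" using joined W by blast
      then obtain p where p: "p \<noteq> []" "hd p = z" "last p \<in> W" "set (butlast p) \<inter> W = {}"
        "distinct p" "trail_edges p \<subseteq> E"
        using z(3) by (rule joined_path_into)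
      \<comment> \<open>The last edge of \<open>p\<close> is the one that crosses into
        \<open>W\<close>.\<close>
      have "butlast p \<noteq> []" using p z by (cases p) auto
      then have "p = butlast (butlast p) @ last (butlast p) # [last p]"
        by (metis append.assoc append_Cons append_Nil append_butlast_last_id p(1))
      then have "trail_edges p = trail_edges (butlast (butlast p) @ [last (butlast p)])
          \<union> trail_edges (last (butlast p) # [last p])"
        by (metis trail_edges_append)
      then have "{last p, last (butlast p)} \<in> E" using p(6) by (auto simp: insert_commute)
      moreover from this have "last (butlast p) \<in> V" using E_sub by blast
      moreover have "last (butlast p) \<notin> W" using \<open>butlast p \<noteq> []\<close> p(4) last_in_set by blast
      ultimately show ?thesis using p(3) by blast
    qed
    then obtain x y where xy: "x \<in> W" "y \<in> V" "y \<notin> W" "{x, y} \<in> E" by blast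
    have "joined (E - {{x, y}}) y x" using joined_del xy W by blast
    then obtain p where p: "p \<noteq> []" "hd p = y" "last p \<in> W" "set (butlast p) \<inter> W = {}"
      "distinct p" "trail_edges p \<subseteq> E - {{x, y}}"
      using xy(1) by (rule joined_path_into)
    define I where "I = butlast p"
    define z where "z = last p"
    have p_eq: "p = I @ [z]" using p(1) by (simp add: I_def z_def)
    have I: "I \<noteq> []" "hd I = y" using p(2,3) xy(3) by (cases I; auto simp: p_eq)+
    \<comment> \<open>With a single interior vertex the ear would use the edge \<open>{x, y}\<close>
      twice, but \<open>p\<close> avoids it.\<close>
    have len: "length I \<ge> 2" if "x = z"
    proof (rule ccontr)
      assume "\<not> length I \<ge> 2"
      then have "I = [y]" using I by (cases I; cases "tl I") auto
      then show False using p(6) that by (auto simp: p_eq insert_commute)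
    qed
    have edges: "trail_edges (x # I @ [z]) = insert {x, y} (trail_edges p)"
      using I by (cases I) (auto simp: p_eq)
    \<comment> \<open>Each edge of the ear meets \<open>I\<close>, which lies outside
      \<open>W\<close>, whereas edges of \<open>D\<close> lie inside \<open>W\<close>.\<close>
    have disj: "trail_edges (x # I @ [z]) \<inter> D = {}"
    proof (rule ccontr)
      assume "trail_edges (x # I @ [z]) \<inter> D \<noteq> {}"
      then obtain e where e: "e \<in> trail_edges (x # I @ [z])" "e \<in> D" by blast
      then have "e \<inter> set I \<noteq> {}" using trail_edge_meets_interior I by metis
      then show False using e(2) W(4) p(4) by (auto simp: p_eq)
    qed
    have "is_ear W D (x # I @ [z])"
      unfolding is_ear_iff using p xy len disj by (auto simp: p_eq)
    moreover have "trail_edges (x # I @ [z]) \<subseteq> E" using edges p(6) xy(4) by auto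
    moreover have "set (x # I @ [z]) \<subseteq> V"
    proof -
      have "w \<in> V" if w: "w \<in> set I" for w
      proof -
        obtain a b where ab: "I = a @ w # b" using w by (meson split_list)
        have "trail_edges (w # b @ [z]) \<subseteq> E"
          using p(6) trail_edges_append[of a w "b @ [z]"] by (auto simp: p_eq ab)
        then have "{w, hd (b @ [z])} \<in> E" by (cases b) auto
        then show ?thesis using E_sub by blast
      qed
      then show ?thesis using xy(1) p(3) W(2) by (auto simp: p_eq)
    qed
    ultimately show ?thesis using that by blast
  qed
qed

text \<open>Every ear brings at least one new edge, so the number of missing edges decreases, also
  when an ear is added because vertices are missing.\<close>

lemma ears_complete:
  assumes G: "simple_graph V E" "two_edge_connected V E"
    and W: "W \<noteq> {}" "W \<subseteq> V" "D \<subseteq> E" "D \<subseteq> Pow W"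
  shows "\<exists>Fs. ears W D Fs \<and> W \<union> union_verts Fs = V \<and> D \<union> union_edges Fs = E"
  using W
proof (induction "card (E - D)" arbitrary: W D rule: less_induct)
  case less
  show ?case
  proof (cases "D = E \<and> W = V")
    case True
    then show ?thesis by (intro exI[of _ "[]"]) auto
  next
    case False
    then obtain p where p: "is_ear W D p" "set p \<subseteq> V" "trail_edges p \<subseteq> E"
      using exists_new_ear[OF G less.prems] by blast
    obtain x I y where "p = x # I @ [y]" using p(1) is_ear_cases by blast
    then have "trail_edges p \<noteq> {}" by (cases I) auto
    moreover have "trail_edges p \<inter> D = {}" using p(1) by (simp add: is_ear_def)
    moreover have "finite E"
      using G(1) by (intro finite_subset[of E "Pow V"]) (auto simp: simple_graph_def)
    ultimately have "card (E - (D \<union> trail_edges p)) < card (E - D)"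
      using p(3) by (intro psubset_card_mono) auto
    moreover have "D \<union> trail_edges p \<subseteq> Pow (W \<union> set p)"
      using less.prems(4) trail_edges_subset by fastforce
    ultimately obtain Fs where "ears (W \<union> set p) (D \<union> trail_edges p) Fs"
        "(W \<union> set p) \<union> union_verts Fs = V" "(D \<union> trail_edges p) \<union> union_edges Fs = E"
      using less.hyps[of "D \<union> trail_edges p" "W \<union> set p"] less.prems p by auto
    then show ?thesis using p(1) by (intro exI[of _ "p # Fs"]) auto
  qed
qed

text \<open>\<open>E \<noteq> {}\<close> excludes the one-vertex graph, which is connected and
  bridgeless but has no cycle to start with.\<close>

lemma ear_decomposition_exists:
  assumes "simple_graph V E" "two_edge_connected V E" "E \<noteq> {}"
  shows "\<exists>Fs. ear_decomposition V E Fs"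
proof -
  obtain a where a: "a \<in> V"
    using assms(2) by (auto simp: two_edge_connected_def graph_connected_def)
  obtain Fs where Fs: "ears {a} {} Fs" "{a} \<union> union_verts Fs = V" "union_edges Fs = E"
    using ears_complete[OF assms(1,2), of "{a}" "{}"] a by auto
  obtain p Gs where p: "Fs = p # Gs" using Fs(3) assms(3) by (cases Fs) auto
  then have "hd p = a" using Fs(1) by (simp add: is_ear_singleton)
  moreover from this have "a \<in> union_verts Fs"
    using Fs(1) p is_ear_cases by (fastforce simp: p)
  ultimately show ?thesis
    using Fs p by (intro exI[of _ Fs]) (auto simp: ear_decomposition_iff)
qed

theorem theorem5p2:
  fixes V :: "'a set" and E :: "'a set set"
  assumes "simple_graph V E"
    and "two_edge_connected V E"
    and "\<not> bipartite V E"
  shows "(\<exists>Fs. optimal_ear_decomposition V E Fs \<and> starts_with_odd_cycle Fs) \<and>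
         phi_odd V E = phi V E"
proof -
  have "E \<noteq> {}" using assms(1,3) two_col_imp_bipartite[of V E] by (auto simp: two_col_def)
  then obtain Fs0 where "ear_decomposition V E Fs0"
    using ear_decomposition_exists assms by blast
  then have "\<exists>k Fs. ear_decomposition V E Fs \<and> num_even_ears Fs = k" by blast
  \<comment> \<open>Existence of a decomposition ensures that the minimum is attained.\<close>
  from LeastI_ex[OF this] obtain Fs where Fs: "ear_decomposition V E Fs" "num_even_ears Fs = phi V E"
    unfolding phi_def by blast
  have phi_le: "phi V E \<le> num_even_ears Gs" if "ear_decomposition V E Gs" for Gs
    unfolding phi_def using that by (intro Least_le) blast
  obtain Gs where Gs: "ear_decomposition V E Gs" "starts_with_odd_cycle Gs"
    "num_even_ears Gs \<le> num_even_ears Fs"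
    using odd_start[OF Fs(1) assms(1,3)] by blast
  then have opt: "num_even_ears Gs = phi V E" using phi_le Fs(2) by (metis le_antisym)
  \<comment> \<open>\<open>Gs\<close> attains \<open>phi V E\<close>, which bounds all
    decompositions from below, in particular those with odd first cycle.\<close>
  have "phi_odd V E = phi V E"
    unfolding phi_odd_def
    by (rule Least_equality) (use Gs opt phi_le in auto)
  then show ?thesis using Gs opt by (auto simp: optimal_ear_decomposition_def)
qed

end
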